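(* The ai-semiring $SR_6$ is nonfinitely based; that is, the variety $\mathsf{V}(SR_6)$ it generates cannot be defined by any finite set of identities.
   Context: An ai-semiring is an algebra $(S,+,\cdot)$ (two binary operations, no constants) such that $(S,+)$ is a commutative idempotent semigroup, $(S,\cdot)$ is a semigroup, and multiplication distributes over addition on both sides. $SR_6$ is the ai-semiring with underlying set $\{1,2,3,4,5,6\}$ and the following commutative operations. Addition: $i+i=i$ for all $i$; $2+5=5+2=2$; $4+6=6+4=4$; all other sums of two distinct elements equal $1$. Multiplication: $2\cdot 6=6\cdot 2=3$, $4\cdot 5=5\cdot 4=3$, $5\cdot 6=6\cdot 5=3$; all other products equal $1$. *)

theory Defs
  imports Main "HOL-Library.FuncSet"
begin

section \<open>Algebras with two binary operations, and ai-semirings\<close>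

record 'a alg =
  carrier :: "'a set"
  add :: "'a \<Rightarrow> 'a \<Rightarrow> 'a"
  mul :: "'a \<Rightarrow> 'a \<Rightarrow> 'a"

locale ai_semiring =
  fixes S :: "'a alg"
  assumes nonempty: "carrier S \<noteq> {}"
    and add_closed: "\<lbrakk>x \<in> carrier S; y \<in> carrier S\<rbrakk> \<Longrightarrow> add S x y \<in> carrier S"
    and mul_closed: "\<lbrakk>x \<in> carrier S; y \<in> carrier S\<rbrakk> \<Longrightarrow> mul S x y \<in> carrier S"
    and add_assoc: "\<lbrakk>x \<in> carrier S; y \<in> carrier S; z \<in> carrier S\<rbrakk> \<Longrightarrow>
          add S (add S x y) z = add S x (add S y z)"
    and add_comm: "\<lbrakk>x \<in> carrier S; y \<in> carrier S\<rbrakk> \<Longrightarrow> add S x y = add S y x"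
    and add_idem: "x \<in> carrier S \<Longrightarrow> add S x x = x"
    and mul_assoc: "\<lbrakk>x \<in> carrier S; y \<in> carrier S; z \<in> carrier S\<rbrakk> \<Longrightarrow>
          mul S (mul S x y) z = mul S x (mul S y z)"
    and distrib_left: "\<lbrakk>x \<in> carrier S; y \<in> carrier S; z \<in> carrier S\<rbrakk> \<Longrightarrow>
          mul S x (add S y z) = add S (mul S x y) (mul S x z)"
    and distrib_right: "\<lbrakk>x \<in> carrier S; y \<in> carrier S; z \<in> carrier S\<rbrakk> \<Longrightarrow>
          mul S (add S x y) z = add S (mul S x z) (mul S y z)"

section \<open>Identities\<close>

datatype 'v trm = Var 'v | Add "'v trm" "'v trm" | Mul "'v trm" "'v trm"

primrec eval :: "'a alg \<Rightarrow> ('v \<Rightarrow> 'a) \<Rightarrow> 'v trm \<Rightarrow> 'a" where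
  "eval S \<theta> (Var v) = \<theta> v"
| "eval S \<theta> (Add s t) = add S (eval S \<theta> s) (eval S \<theta> t)"
| "eval S \<theta> (Mul s t) = mul S (eval S \<theta> s) (eval S \<theta> t)"

type_synonym 'v identity = "'v trm \<times> 'v trm"

definition satisfies :: "'a alg \<Rightarrow> 'v identity \<Rightarrow> bool" where
  "satisfies S e \<longleftrightarrow>
    (\<forall>\<theta>. range \<theta> \<subseteq> carrier S \<longrightarrow> eval S \<theta> (fst e) = eval S \<theta> (snd e))"

section \<open>The variety generated by an algebra\<close>

definition direct_product :: "'i set \<Rightarrow> ('i \<Rightarrow> 'a alg) \<Rightarrow> ('i \<Rightarrow> 'a) alg" where
  "direct_product I F =
    \<lparr>carrier = (\<Pi>\<^sub>E i\<in>I. carrier (F i)),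
     add = (\<lambda>f g. \<lambda>i\<in>I. add (F i) (f i) (g i)),
     mul = (\<lambda>f g. \<lambda>i\<in>I. mul (F i) (f i) (g i))\<rparr>"

definition subuniverse :: "'a set \<Rightarrow> 'a alg \<Rightarrow> bool" where
  "subuniverse B A \<longleftrightarrow> B \<noteq> {} \<and> B \<subseteq> carrier A \<and>
    (\<forall>x\<in>B. \<forall>y\<in>B. add A x y \<in> B \<and> mul A x y \<in> B)"

definition subalgebras :: "'a alg \<Rightarrow> 'a alg set" where
  "subalgebras A = {A\<lparr>carrier := B\<rparr> | B. subuniverse B A}"

definition surj_hom :: "('a \<Rightarrow> 'b) \<Rightarrow> 'a alg \<Rightarrow> 'b alg \<Rightarrow> bool" where
  "surj_hom h A B \<longleftrightarrow> h ` carrier A = carrier B \<and>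
    (\<forall>x\<in>carrier A. \<forall>y\<in>carrier A.
      h (add A x y) = add B (h x) (h y) \<and> h (mul A x y) = mul B (h x) (h y))"

text \<open>
  The variety generated by \<open>S\<close> is the class of all homomorphic images of subalgebras of direct
  powers of \<open>S\<close>, here restricted to its members with carrier in \<^typ>\<open>'b\<close>. Choosing the index
  sets of the powers in \<^typ>\<open>'b \<Rightarrow> 's\<close> loses nothing: an algebra \<open>A\<close> in the variety is an image
  of the algebra freely generated in it by the elements of \<open>A\<close>, which embeds in the power of
  \<open>S\<close> indexed by the maps from \<open>A\<close> to \<open>S\<close>. Lemma \<open>variety_eq_models\<close> below confirms this.
\<close>

definition variety :: "'s alg \<Rightarrow> 'b alg set" where
  "variety S = {A. \<exists>(I :: ('b \<Rightarrow> 's) set) B h.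
     B \<in> subalgebras (direct_product I (\<lambda>_. S)) \<and> surj_hom h B A}"

text \<open>
  Identities are imposed on top of the ai-semiring axioms. These are finitely many identities
  themselves, so it is immaterial for finite axiomatizability whether they are presupposed.
\<close>

definition defined_by :: "'b alg set \<Rightarrow> 'v identity set \<Rightarrow> bool" where
  "defined_by K \<Sigma> \<longleftrightarrow>
    K = {A. ai_semiring A \<and> (\<forall>e\<in>\<Sigma>. satisfies A e)}"

text \<open>
  The comparison is restricted to algebras with carrier a subset of \<^typ>\<open>nat\<close>, that is, up to
  isomorphism, to countable algebras. If \<open>\<Sigma>\<close> defines the variety among all ai-semirings, it does
  so among the countable ones, so the negation below covers the unrestricted notion. Conversely, an
  identity that fails in an algebra fails in a finitely generated, hence countable, subalgebra, so
  nothing is lost in the other direction either.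
\<close>

definition finitely_based :: "'s alg \<Rightarrow> bool" where
  "finitely_based S \<longleftrightarrow>
    (\<exists>\<Sigma> :: nat identity set. finite \<Sigma> \<and> defined_by (variety S :: nat alg set) \<Sigma>)"

abbreviation nonfinitely_based :: "'s alg \<Rightarrow> bool" where
  "nonfinitely_based S \<equiv> \<not> finitely_based S"

section \<open>The ai-semiring \<open>SR\<^sub>6\<close>\<close>

definition SR6 :: "nat alg" where
  "SR6 = \<lparr>carrier = {1, 2, 3, 4, 5, 6},
     add = (\<lambda>i j. if i = j then i
                  else if {i, j} = {2, 5} then 2
                  else if {i, j} = {4, 6} then 4
                  else 1),
     mul = (\<lambda>i j. if {i, j} = {2, 6} \<or> {i, j} = {4, 5} \<or> {i, j} = {5, 6} then 3 else 1)\<rparr>"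

lemma ai_semiring_SR6: "ai_semiring SR6"
proof -
  let ?C = "carrier SR6" and ?a = "add SR6" and ?m = "mul SR6"
  have "\<forall>x\<in>?C. \<forall>y\<in>?C. ?a x y \<in> ?C \<and> ?m x y \<in> ?C \<and> ?a x y = ?a y x"
    by (simp add: SR6_def doubleton_eq_iff)
  moreover have "\<forall>x\<in>?C. \<forall>y\<in>?C. \<forall>z\<in>?C. ?a (?a x y) z = ?a x (?a y z)"
    by (simp add: SR6_def doubleton_eq_iff)
  moreover have "\<forall>x\<in>?C. \<forall>y\<in>?C. \<forall>z\<in>?C. ?m (?m x y) z = ?m x (?m y z)"
    by (simp add: SR6_def doubleton_eq_iff)
  moreover have "\<forall>x\<in>?C. \<forall>y\<in>?C. \<forall>z\<in>?C.
      ?m x (?a y z) = ?a (?m x y) (?m x z) \<and> ?m (?a x y) z = ?a (?m x z) (?m y z)"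
    by (simp add: SR6_def doubleton_eq_iff)
  moreover have "?C \<noteq> {}" "\<forall>x\<in>?C. ?a x x = x"
    by (simp_all add: SR6_def)
  ultimately show ?thesis
    by unfold_locales blast+
qed

section \<open>The generated variety is the class of models of the identities of its generator\<close>

lemma eval_closed:
  assumes "subuniverse (carrier A) A" "range \<theta> \<subseteq> carrier A"
  shows "eval A \<theta> t \<in> carrier A"
  using assms by (induction t) (auto simp: subuniverse_def)

lemma eval_map_trm: "eval A \<theta> (map_trm f t) = eval A (\<theta> \<circ> f) t"
  by (induction t) auto

lemma eval_cong: "(\<And>v. v \<in> set_trm t \<Longrightarrow> \<theta> v = \<theta>' v) \<Longrightarrow> eval A \<theta> t = eval A \<theta>' t"
  by (induction t) auto

lemma finite_set_trm: "finite (set_trm t)"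
  by (induction t) auto

lemma eval_direct_product:
  assumes "i \<in> I"
  shows "eval (direct_product I F) \<theta> t i = eval (F i) (\<lambda>v. \<theta> v i) t"
  using assms by (induction t) (auto simp: direct_product_def)

lemma satisfies_direct_product:
  assumes "\<And>i. i \<in> I \<Longrightarrow> satisfies (F i) e"
    and "\<And>i. i \<in> I \<Longrightarrow> subuniverse (carrier (F i)) (F i)"
  shows "satisfies (direct_product I F) e"
  unfolding satisfies_def
proof (intro allI impI)
  fix \<theta> :: "'c \<Rightarrow> 'a \<Rightarrow> 'b"
  assume \<theta>: "range \<theta> \<subseteq> carrier (direct_product I F)"
  then have ext: "eval (direct_product I F) \<theta> t \<in> extensional I" for t
    by (cases t) (auto simp: direct_product_def PiE_def)
  show "eval (direct_product I F) \<theta> (fst e) = eval (direct_product I F) \<theta> (snd e)"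
  proof (rule extensionalityI[OF ext ext])
    fix i assume i: "i \<in> I"
    have "range (\<lambda>v. \<theta> v i) \<subseteq> carrier (F i)"
      using \<theta> i by (auto simp: direct_product_def PiE_def Pi_def image_subset_iff)
    then show "eval (direct_product I F) \<theta> (fst e) i = eval (direct_product I F) \<theta> (snd e) i"
      using assms(1)[OF i] by (simp add: eval_direct_product[OF i] satisfies_def)
  qed
qed

lemma eval_carrier_update: "eval (A\<lparr>carrier := B\<rparr>) \<theta> t = eval A \<theta> t"
  by (induction t) auto

lemma satisfies_subalgebra:
  "\<lbrakk>satisfies A e; B \<in> subalgebras A\<rbrakk> \<Longrightarrow> satisfies B e"
  by (auto simp: satisfies_def subalgebras_def subuniverse_def eval_carrier_update)

lemma subuniverse_subalgebra:
  "B \<in> subalgebras A \<Longrightarrow> subuniverse (carrier B) B"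
  by (auto simp: subalgebras_def subuniverse_def)

lemma eval_surj_hom:
  assumes "surj_hom h B A" "subuniverse (carrier B) B" "range \<theta> \<subseteq> carrier B"
  shows "h (eval B \<theta> t) = eval A (h \<circ> \<theta>) t"
proof (induction t)
  case (Add s t)
  then show ?case
    using assms eval_closed[OF assms(2,3)] by (simp add: surj_hom_def)
next
  case (Mul s t)
  then show ?case
    using assms eval_closed[OF assms(2,3)] by (simp add: surj_hom_def)
qed simp

lemma satisfies_surj_hom:
  assumes h: "surj_hom h B A" and B: "subuniverse (carrier B) B" and e: "satisfies B e"
  shows "satisfies A e"
  unfolding satisfies_def
proof (intro allI impI)
  fix \<theta> :: "'c \<Rightarrow> 'b" assume \<theta>: "range \<theta> \<subseteq> carrier A"
  define \<eta> where "\<eta> v = inv_into (carrier B) h (\<theta> v)" for v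
  have *: "\<theta> v \<in> h ` carrier B" for v
    using \<theta> h by (auto simp: surj_hom_def)
  have 1: "range \<eta> \<subseteq> carrier B" and 2: "h \<circ> \<eta> = \<theta>"
    using inv_into_into[OF *] f_inv_into_f[OF *] by (auto simp: \<eta>_def)
  show "eval A \<theta> (fst e) = eval A \<theta> (snd e)"
    using eval_surj_hom[OF h B 1] e 1 2 by (metis satisfies_def)
qed

lemma satisfies_change_variables:
  fixes s t :: "'v trm"
  assumes A: "carrier A \<noteq> {}"
    and S: "\<And>e :: nat identity. satisfies S e \<Longrightarrow> satisfies A e"
    and st: "satisfies S (s, t)"
  shows "satisfies A (s, t)"
proof -
  obtain f :: "'v \<Rightarrow> nat" where f: "inj_on f (set_trm s \<union> set_trm t)"
    using finite_imp_inj_to_nat_seg[of "set_trm s \<union> set_trm t"] finite_set_trm by blast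
  have "satisfies S (map_trm f s, map_trm f t)"
    using st by (auto simp: satisfies_def eval_map_trm image_subset_iff)
  then have A': "satisfies A (map_trm f s, map_trm f t)"
    by (rule S)
  obtain a where a: "a \<in> carrier A"
    using A by blast
  show ?thesis
    unfolding satisfies_def
  proof (intro allI impI)
    fix \<theta> :: "'v \<Rightarrow> 'a" assume \<theta>: "range \<theta> \<subseteq> carrier A"
    define \<eta> where "\<eta> = \<theta> \<circ> inv_into (set_trm s \<union> set_trm t) f"
    have "range \<eta> \<subseteq> carrier A"
      using \<theta> by (auto simp: \<eta>_def)
    then have "eval A (\<eta> \<circ> f) s = eval A (\<eta> \<circ> f) t"
      using A' by (simp add: satisfies_def eval_map_trm)
    moreover have "eval A (\<eta> \<circ> f) s = eval A \<theta> s" "eval A (\<eta> \<circ> f) t = eval A \<theta> t"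
      using f by (auto intro!: eval_cong simp: \<eta>_def)
    ultimately show "eval A \<theta> (fst (s, t)) = eval A \<theta> (snd (s, t))"
      by simp
  qed
qed

lemma variety_eq_models:
  fixes S :: "'s alg"
  assumes S: "subuniverse (carrier S) S"
  shows "(variety S :: 'b alg set) =
    {A. subuniverse (carrier A) A \<and> (\<forall>e :: nat identity. satisfies S e \<longrightarrow> satisfies A e)}"
    (is "_ = ?M")
proof (intro set_eqI iffI)
  fix A :: "'b alg" assume "A \<in> variety S"
  then obtain I :: "('b \<Rightarrow> 's) set" and B h
    where B: "B \<in> subalgebras (direct_product I (\<lambda>_. S))" and h: "surj_hom h B A"
    by (auto simp: variety_def)
  note B' = subuniverse_subalgebra[OF B]
  have "satisfies A e" if "satisfies S e" for e :: "nat identity"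
    using that satisfies_direct_product[of I "\<lambda>_. S" e] S
    by (intro satisfies_surj_hom[OF h B'] satisfies_subalgebra[OF _ B]) auto
  moreover have "subuniverse (carrier A) A"
    unfolding subuniverse_def
  proof (intro conjI ballI)
    show "carrier A \<noteq> {}"
      using h B' by (auto simp: surj_hom_def subuniverse_def)
    fix x y assume "x \<in> carrier A" "y \<in> carrier A"
    then have "x \<in> h ` carrier B" "y \<in> h ` carrier B"
      using h by (simp_all add: surj_hom_def)
    then obtain u v where uv: "u \<in> carrier B" "v \<in> carrier B" "x = h u" "y = h v"
      by blast
    have "add A x y = h (add B u v)" "mul A x y = h (mul B u v)"
      and "add B u v \<in> carrier B" "mul B u v \<in> carrier B"
      using uv h B' by (auto simp: surj_hom_def subuniverse_def)
    then show "add A x y \<in> carrier A" "mul A x y \<in> carrier A"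
      using h by (auto simp: surj_hom_def)
  qed simp
  ultimately show "A \<in> ?M"
    by simp
next
  fix A :: "'b alg" assume "A \<in> ?M"
  then have A: "subuniverse (carrier A) A"
    and id: "\<And>e :: nat identity. satisfies S e \<Longrightarrow> satisfies A e"
    by auto
  from A obtain a where a: "a \<in> carrier A"
    by (auto simp: subuniverse_def)
  define I :: "('b \<Rightarrow> 's) set" where "I = {\<theta>. range \<theta> \<subseteq> carrier S}"
  define P where "P = direct_product I (\<lambda>_. S)"
  define \<phi> :: "'b trm \<Rightarrow> ('b \<Rightarrow> 's) \<Rightarrow> 's" where "\<phi> t = (\<lambda>\<theta>\<in>I. eval S \<theta> t)" for t
  define \<alpha> where "\<alpha> b = (if b \<in> carrier A then b else a)" for b
  define h where "h p = eval A \<alpha> (SOME t. \<phi> t = p)" for p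
  have \<alpha>: "range \<alpha> \<subseteq> carrier A"
    using a by (auto simp: \<alpha>_def)
  have add: "add P (\<phi> s) (\<phi> t) = \<phi> (Add s t)" and mul: "mul P (\<phi> s) (\<phi> t) = \<phi> (Mul s t)" for s t
    by (auto simp: P_def direct_product_def \<phi>_def)
  have h: "h (\<phi> t) = eval A \<alpha> t" for t
  proof -
    have "\<phi> (SOME t'. \<phi> t' = \<phi> t) = \<phi> t"
      by (rule someI) simp
    then have "satisfies S ((SOME t'. \<phi> t' = \<phi> t), t)"
      by (auto simp: \<phi>_def I_def satisfies_def restrict_def fun_eq_iff split: if_splits)
    then have "satisfies A ((SOME t'. \<phi> t' = \<phi> t), t)"
      using satisfies_change_variables[of A S] a id by blast
    then show ?thesis
      using \<alpha> by (simp add: h_def satisfies_def)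
  qed
  have "\<phi> t \<in> carrier P" for t
    using eval_closed[OF S] by (auto simp: P_def direct_product_def \<phi>_def I_def)
  then have "P\<lparr>carrier := range \<phi>\<rparr> \<in> subalgebras P"
    unfolding subalgebras_def subuniverse_def by (auto simp: add mul)
  moreover have "surj_hom h (P\<lparr>carrier := range \<phi>\<rparr>) A"
    unfolding surj_hom_def
  proof (intro conjI ballI)
    have "b \<in> h ` range \<phi>" if "b \<in> carrier A" for b
      using that h[of "Var b"] by (metis \<alpha>_def eval.simps(1) rangeI image_eqI)
    then show "h ` carrier (P\<lparr>carrier := range \<phi>\<rparr>) = carrier A"
      using h eval_closed[OF A \<alpha>] by auto
  qed (auto simp: add mul h)
  ultimately show "A \<in> variety S"
    unfolding variety_def P_def by blast
qed

end

theory Submission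
  imports Defs
begin

text \<open>
  In \<open>SR\<^sub>6\<close> every product of three factors is \<open>1\<close>, which is also the top element for addition. So a
  term with a longer monomial is constantly \<open>1\<close>; the others are sums of variables and of products
  of two variables, and these products are the edges of a graph on the variables. The only nontrivial product is \<open>3\<close>, and it arises exactly along the
  edges of the path \<open>2 - 6 - 5 - 4\<close>. Hence a sum of products \<open>x y\<close> takes a value other than \<open>1\<close> under
  some assignment iff its graph is bipartite. Each odd cycle thus gives an identity, which says that
  the cycle term is constantly \<open>1\<close> (\<open>SR6_odd_cycle\<close>). A bipartite graph, in contrast, is determined
  by its term function: since \<open>2 \<cdot> 4 = 1\<close> while all other products between the two sides \<open>{2, 5}\<close> and
  \<open>{4, 6}\<close> are \<open>3\<close>, one assignment detects whether a given pair of variables from different sides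
  is an edge (\<open>SR6_identity_bipartite\<close>).

  The identities in at most \<open>k\<close> variables do not imply those of the longer odd cycles. Let \<open>C\<close> be an
  odd cycle with more than \<open>k\<close> vertices, and consider the sums of vertices and the sums of edges of
  \<open>C\<close>, with all other sums and products collapsed to a top element. This is an ai-semiring that
  refutes the identity of \<open>C\<close>. If a term \<open>s\<close> in at most \<open>k\<close> variables has a value below the top,
  then choosing a vertex in the value of each variable maps the graph of \<open>s\<close> homomorphically into a
  proper part of \<open>C\<close>, which is bipartite. Consequently every identity \<open>s = t\<close> of \<open>SR\<^sub>6\<close> forces \<open>t\<close> to
  have the same monomials as \<open>s\<close> up to commutativity, and it holds in the new ai-semiring
  (\<open>graph_alg_satisfies_small\<close>).
\<close>

section \<open>Finite bases bound the number of variables\<close>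

lemma (in ai_semiring) subuniverse_carrier: "subuniverse (carrier S) S"
  using nonempty add_closed mul_closed by (auto simp: subuniverse_def)

lemma (in ai_semiring) eval_in_carrier: "range \<theta> \<subseteq> carrier S \<Longrightarrow> eval S \<theta> t \<in> carrier S"
  using eval_closed subuniverse_carrier by blast

lemma ai_semiring_surj_hom:
  assumes A: "ai_semiring A" and h: "surj_hom h A B"
  shows "ai_semiring B"
proof -
  interpret ai_semiring A by (fact A)
  have img: "carrier B = h ` carrier A"
    and ha: "\<And>x y. \<lbrakk>x \<in> carrier A; y \<in> carrier A\<rbrakk> \<Longrightarrow> add B (h x) (h y) = h (add A x y)"
    and hm: "\<And>x y. \<lbrakk>x \<in> carrier A; y \<in> carrier A\<rbrakk> \<Longrightarrow> mul B (h x) (h y) = h (mul A x y)"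
    using h by (auto simp: surj_hom_def)
  have comm: "add B x y = add B y x" if "x \<in> carrier B" "y \<in> carrier B" for x y
    using that add_comm by (auto simp: img ha)
  show ?thesis
    by unfold_locales
      (rule comm; assumption | auto simp: img ha hm nonempty add_closed mul_closed add_assoc add_idem
        mul_assoc distrib_left distrib_right; fail)+
qed

lemma finite_alg_copy_nat:
  fixes A :: "'a alg"
  assumes fin: "finite (carrier A)" and A: "subuniverse (carrier A) A"
  obtains B :: "nat alg" and f g where "surj_hom f A B" "surj_hom g B A"
proof -
  obtain f :: "'a \<Rightarrow> nat" where f: "inj_on f (carrier A)"
    using finite_imp_inj_to_nat_seg[OF fin] by blast
  define g where "g = inv_into (carrier A) f"
  define B where "B = \<lparr>carrier = f ` carrier A, add = (\<lambda>x y. f (add A (g x) (g y))),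
    mul = (\<lambda>x y. f (mul A (g x) (g y)))\<rparr>"
  have g: "g (f x) = x" if "x \<in> carrier A" for x
    using f that by (simp add: g_def)
  have "surj_hom f A B" "surj_hom g B A"
    using A by (auto simp: surj_hom_def B_def g subuniverse_def image_image)
  then show thesis
    by (rule that)
qed

text \<open>
  This is what a finite basis is used for: its identities have at most \<open>k\<close> variables on each side,
  so a finite ai-semiring that satisfies such identities of \<open>S\<close> has an isomorphic copy in the
  variety, and then satisfies all identities of \<open>S\<close>. The copy is taken because \<^const>\<open>finitely_based\<close>
  speaks of algebras on \<^typ>\<open>nat\<close>.
\<close>

lemma finitely_based_bounded_variables:
  fixes S :: "nat alg"
  assumes S: "ai_semiring S" and fb: "finitely_based S"
  obtains k where "\<And>(A :: 'a alg) e. \<lbrakk>ai_semiring A; finite (carrier A);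
      \<And>s t :: nat trm. \<lbrakk>satisfies S (s, t); card (set_trm s) \<le> k; card (set_trm t) \<le> k\<rbrakk>
        \<Longrightarrow> satisfies A (s, t);
      satisfies S (e :: nat identity)\<rbrakk> \<Longrightarrow> satisfies A e"
proof -
  obtain \<Sigma> :: "nat identity set" where fin: "finite \<Sigma>"
    and V: "variety S = {A :: nat alg. ai_semiring A \<and> (\<forall>e\<in>\<Sigma>. satisfies A e)}"
    using fb by (auto simp: finitely_based_def defined_by_def)
  note subS = ai_semiring.subuniverse_carrier[OF S]
  note models = variety_eq_models[OF subS, where 'b = nat]
  have "S \<in> variety S"
    using subS by (simp add: models)
  then have \<Sigma>: "satisfies S e" if "e \<in> \<Sigma>" for e
    using V that by blast
  define k where "k = (\<Sum>e\<in>\<Sigma>. card (set_trm (fst e)) + card (set_trm (snd e)))"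
  have k: "card (set_trm (fst e)) \<le> k" "card (set_trm (snd e)) \<le> k" if "e \<in> \<Sigma>" for e
    using member_le_sum[OF that, of "\<lambda>e. card (set_trm (fst e)) + card (set_trm (snd e))"] fin
    by (auto simp: k_def)
  show thesis
  proof (rule that)
    fix A :: "'a alg" and e :: "nat identity"
    assume A: "ai_semiring A" and finA: "finite (carrier A)" and e: "satisfies S e"
      and small: "\<And>s t :: nat trm. \<lbrakk>satisfies S (s, t); card (set_trm s) \<le> k;
        card (set_trm t) \<le> k\<rbrakk> \<Longrightarrow> satisfies A (s, t)"
    note subA = ai_semiring.subuniverse_carrier[OF A]
    obtain B :: "nat alg" and f g where f: "surj_hom f A B" and g: "surj_hom g B A"
      using finite_alg_copy_nat[OF finA subA] .
    have B: "ai_semiring B"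
      by (rule ai_semiring_surj_hom[OF A f])
    have "satisfies B d" if "d \<in> \<Sigma>" for d
      using small[of "fst d" "snd d"] \<Sigma>[OF that] k[OF that]
      by (intro satisfies_surj_hom[OF f subA]) simp
    then have "B \<in> variety S"
      using V B by blast
    then have "satisfies B e"
      using e unfolding models by blast
    then show "satisfies A e"
      by (rule satisfies_surj_hom[OF g ai_semiring.subuniverse_carrier[OF B]])
  qed
qed

section \<open>Terms over semirings in which products of three factors vanish\<close>

text \<open>
  By distributivity a term is a sum of monomials. Where all products of three factors are equal,
  what matters is which variables and which products of two variables are among the
  monomials, and whether there is a longer one.
\<close>

primrec lin :: "'v trm \<Rightarrow> 'v set" where
  "lin (Var v) = {v}"
| "lin (Add s t) = lin s \<union> lin t"
| "lin (Mul s t) = {}"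

primrec quad :: "'v trm \<Rightarrow> ('v \<times> 'v) set" where
  "quad (Var v) = {}"
| "quad (Add s t) = quad s \<union> quad t"
| "quad (Mul s t) = lin s \<times> lin t"

primrec long :: "'v trm \<Rightarrow> bool" where
  "long (Var v) = False"
| "long (Add s t) = (long s \<or> long t)"
| "long (Mul s t) = (quad s \<noteq> {} \<or> quad t \<noteq> {} \<or> long s \<or> long t)"

lemma lin_subset: "lin t \<subseteq> set_trm t"
  by (induction t) auto

lemma quad_subset: "quad t \<subseteq> set_trm t \<times> set_trm t"
proof (induction t)
  case (Mul s t)
  then show ?case using lin_subset[of s] lin_subset[of t] by auto
qed auto

lemma has_monomial: "lin t \<noteq> {} \<or> quad t \<noteq> {} \<or> long t"
  by (induction t) auto

locale nilpotent3 = ai_semiring S for S :: "'a alg" +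
  fixes top :: 'a
  assumes top_closed: "top \<in> carrier S"
    and add_top: "x \<in> carrier S \<Longrightarrow> add S x top = top"
    and mul3: "\<lbrakk>x \<in> carrier S; y \<in> carrier S; z \<in> carrier S\<rbrakk> \<Longrightarrow> mul S (mul S x y) z = top"
    and mul_comm: "\<lbrakk>x \<in> carrier S; y \<in> carrier S\<rbrakk> \<Longrightarrow> mul S x y = mul S y x"
begin

lemma top_mul: "x \<in> carrier S \<Longrightarrow> mul S top x = top"
  using mul3[of x x x] mul3[of "mul S x x" x x] mul_closed by simp

lemma mul_top: "x \<in> carrier S \<Longrightarrow> mul S x top = top"
  using top_mul[of x] mul_comm[of x top] top_closed by simp

definition additive :: "('a \<Rightarrow> bool) \<Rightarrow> bool" where
  "additive P \<longleftrightarrow> (\<forall>x\<in>carrier S. \<forall>y\<in>carrier S. P (add S x y) \<longleftrightarrow> P x \<and> P y)"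

text \<open>
  An additive predicate holds of a sum of monomials iff it holds of each of them. Quantifying over
  the predicate makes the induction work: at a product, distributivity says that
  \<open>\<lambda>x. P (x \<cdot> b)\<close> and \<open>\<lambda>x. P (a \<cdot> x)\<close> are again additive.
\<close>

lemma additive_eval:
  assumes \<theta>: "range \<theta> \<subseteq> carrier S" and P: "additive P"
  shows "P (eval S \<theta> t) \<longleftrightarrow> (\<forall>x\<in>lin t. P (\<theta> x)) \<and>
    (\<forall>(x, y)\<in>quad t. P (mul S (\<theta> x) (\<theta> y))) \<and> (long t \<longrightarrow> P top)"
  using P
proof (induction t arbitrary: P)
  case (Var v)
  then show ?case by simp
next
  case (Add s t)
  have "P (eval S \<theta> (Add s t)) \<longleftrightarrow> P (eval S \<theta> s) \<and> P (eval S \<theta> t)"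
    using Add.prems eval_in_carrier[OF \<theta>] by (simp add: additive_def)
  then show ?case
    unfolding Add.IH(1)[OF Add.prems] Add.IH(2)[OF Add.prems] by auto
next
  case (Mul s t)
  have \<theta>': "\<theta> x \<in> carrier S" for x
    using \<theta> by auto
  have t: "eval S \<theta> t \<in> carrier S"
    by (rule eval_in_carrier[OF \<theta>])
  have "additive (\<lambda>a. P (mul S a (eval S \<theta> t)))"
    using Mul.prems t by (simp add: additive_def distrib_right mul_closed)
  note s_iff = Mul.IH(1)[OF this, simplified]
  have "additive (\<lambda>b. P (mul S (\<theta> x) b))" for x
    using Mul.prems \<theta>' by (simp add: additive_def distrib_left mul_closed)
  note t_iff = Mul.IH(2)[OF this, simplified]
  have 3: "mul S (\<theta> x) (mul S (\<theta> y) (\<theta> z)) = top" for x y z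
    using mul3 mul_assoc \<theta>' by simp
  show ?case
    using has_monomial[of s] has_monomial[of t]
    by (auto simp: s_iff t_iff t \<theta>' mul3 3 top_mul mul_top)
qed

definition le :: "'a \<Rightarrow> 'a \<Rightarrow> bool" where
  "le x y \<longleftrightarrow> add S x y = y"

lemma additive_le:
  assumes z: "z \<in> carrier S"
  shows "additive (\<lambda>x. le x z)"
  unfolding additive_def le_def
proof (intro ballI iffI conjI)
  fix x y assume x: "x \<in> carrier S" and y: "y \<in> carrier S"
  assume *: "add S (add S x y) z = z"
  show "add S x z = z"
    using * x y z by (metis add_assoc add_closed add_idem)
  show "add S y z = z"
    using * x y z by (metis add_assoc add_closed add_comm add_idem)
next
  fix x y assume "x \<in> carrier S" "y \<in> carrier S" "add S x z = z \<and> add S y z = z"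
  then show "add S (add S x y) z = z"
    using z by (simp add: add_assoc)
qed

lemma le_refl: "x \<in> carrier S \<Longrightarrow> le x x"
  by (simp add: le_def add_idem)

lemma top_le: "x \<in> carrier S \<Longrightarrow> le top x \<longleftrightarrow> x = top"
  using add_comm[of top x] add_top[of x] top_closed by (auto simp: le_def)

text \<open>
  Equality is tested by the additive predicates \<open>\<lambda>x. le x z\<close>, so the monomials up to
  commutativity determine the value.
\<close>

lemma eval_eqI:
  assumes \<theta>: "range \<theta> \<subseteq> carrier S"
    and eq: "lin s = lin t" "quad s \<union> (quad s)\<inverse> = quad t \<union> (quad t)\<inverse>" "long s = long t"
  shows "eval S \<theta> s = eval S \<theta> t"
proof -
  have sym: "(\<forall>(x, y)\<in>quad u. P (mul S (\<theta> x) (\<theta> y))) \<longleftrightarrow>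
      (\<forall>(x, y)\<in>quad u \<union> (quad u)\<inverse>. P (mul S (\<theta> x) (\<theta> y)))" for u P
    using mul_comm \<theta> by (fastforce simp: image_subset_iff)
  have "P (eval S \<theta> s) \<longleftrightarrow> P (eval S \<theta> t)" if "additive P" for P
    using additive_eval[OF \<theta> that, of s] additive_eval[OF \<theta> that, of t]
    by (simp only: eq sym)
  then have "le (eval S \<theta> s) z \<longleftrightarrow> le (eval S \<theta> t) z" if "z \<in> carrier S" for z
    using additive_le[OF that] by blast
  then show ?thesis
    using eval_in_carrier[OF \<theta>] le_refl add_comm unfolding le_def by metis
qed

lemma monomials_le_eval:
  assumes \<theta>: "range \<theta> \<subseteq> carrier S"
  shows "x \<in> lin t \<Longrightarrow> le (\<theta> x) (eval S \<theta> t)"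
    and "(x, y) \<in> quad t \<Longrightarrow> le (mul S (\<theta> x) (\<theta> y)) (eval S \<theta> t)"
    and "long t \<Longrightarrow> eval S \<theta> t = top"
  using additive_eval[OF \<theta> additive_le, of "eval S \<theta> t" t] eval_in_carrier[OF \<theta>, of t]
  by (auto simp: le_refl top_le)

end

section \<open>Identities of \<open>SR\<^sub>6\<close>\<close>

interpretation SR6: nilpotent3 SR6 1
proof -
  interpret ai_semiring SR6 by (rule ai_semiring_SR6)
  show "nilpotent3 SR6 1"
    by unfold_locales (auto simp: SR6_def doubleton_eq_iff)
qed

text \<open>
  Both \<open>3\<close> and \<open>5\<close> are minimal for \<^term>\<open>SR6.le\<close>, so being equal to one of them is an additive
  predicate.
\<close>

lemma eval_SR6_eq_3:
  assumes "range \<theta> \<subseteq> carrier SR6"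
  shows "eval SR6 \<theta> t = 3 \<longleftrightarrow>
    (\<forall>x\<in>lin t. \<theta> x = 3) \<and> (\<forall>(x, y)\<in>quad t. mul SR6 (\<theta> x) (\<theta> y) = 3) \<and> \<not> long t"
proof -
  have "SR6.additive (\<lambda>a. a = 3)"
    unfolding SR6.additive_def by (simp add: SR6_def doubleton_eq_iff)
  from SR6.additive_eval[OF assms this] show ?thesis
    by simp
qed

lemma eval_SR6_eq_5:
  assumes "range \<theta> \<subseteq> carrier SR6"
  shows "eval SR6 \<theta> t = 5 \<longleftrightarrow> (\<forall>x\<in>lin t. \<theta> x = 5) \<and> quad t = {} \<and> \<not> long t"
proof -
  have "SR6.additive (\<lambda>a. a = 5)"
    unfolding SR6.additive_def by (simp add: SR6_def doubleton_eq_iff)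
  moreover have "mul SR6 a b \<noteq> 5" for a b
    by (simp add: SR6_def)
  ultimately show ?thesis
    using SR6.additive_eval[OF assms, of "\<lambda>a. a = 5" t] by auto
qed

text \<open>
  No product equals \<open>5\<close>, so the value \<open>5\<close> recognizes sums of variables. Which variables occur is
  tested by changing the value of one of them from \<open>5\<close> to \<open>1\<close>.
\<close>

lemma SR6_identity_linear:
  fixes s t :: "'v trm"
  assumes st: "satisfies SR6 (s, t)" and s: "quad s = {}" "\<not> long s"
  shows "lin t = lin s \<and> quad t = {} \<and> \<not> long t"
proof -
  have iff: "eval SR6 \<theta> s = 5 \<longleftrightarrow> eval SR6 \<theta> t = 5" if "range \<theta> \<subseteq> carrier SR6" for \<theta>
    using st that by (simp add: satisfies_def)
  have rng: "range (\<lambda>_ :: 'v. 5) \<subseteq> carrier SR6" "range ((\<lambda>_. 5)(x := 1)) \<subseteq> carrier SR6" for x :: 'v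
    by (auto simp: SR6_def)
  have t: "quad t = {}" "\<not> long t"
    using iff[OF rng(1)] s by (auto simp: eval_SR6_eq_5[OF rng(1)])
  have "x \<in> lin t \<longleftrightarrow> x \<in> lin s" for x
    using iff[OF rng(2)[of x]] s t
    by (auto simp: eval_SR6_eq_5[OF rng(2)] simp del: One_nat_def split: if_splits)
  then show ?thesis
    using t by blast
qed

text \<open>
  A 2-colouring \<open>c\<close> of the graph of \<open>s\<close> turns into an assignment that gives \<open>s\<close> the value \<open>3\<close>: the
  linear monomials become \<open>3\<close>, the colour classes \<open>5\<close> and \<open>6\<close>. The term \<open>t\<close> must have the value
  \<open>3\<close> too, which makes \<open>c\<close> a 2-colouring of its graph. Moving one vertex \<open>a\<close> from \<open>5\<close> to \<open>2\<close> and
  one vertex \<open>b\<close> from \<open>6\<close> to \<open>4\<close> changes, among the products between the two classes, only that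
  of \<open>a\<close> and \<open>b\<close>, and so tells whether they are adjacent.
\<close>

lemma SR6_identity_bipartite:
  fixes c :: "'v \<Rightarrow> bool"
  assumes st: "satisfies SR6 (s, t)" and s: "\<not> long s"
    and disj: "\<And>x y. (x, y) \<in> quad s \<Longrightarrow> x \<notin> lin s \<and> y \<notin> lin s"
    and c: "\<And>x y. (x, y) \<in> quad s \<Longrightarrow> c x \<noteq> c y"
  shows "lin t = lin s \<and> quad t \<union> (quad t)\<inverse> = quad s \<union> (quad s)\<inverse> \<and> \<not> long t"
proof -
  have iff: "eval SR6 \<theta> s = 3 \<longleftrightarrow> eval SR6 \<theta> t = 3" if "range \<theta> \<subseteq> carrier SR6" for \<theta>
    using st that by (simp add: satisfies_def)
  define \<theta> where "\<theta> x = (if x \<in> lin s then 3 else if c x then 5 else 6 :: nat)" for x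
  have \<theta>: "range \<theta> \<subseteq> carrier SR6"
    by (auto simp: \<theta>_def SR6_def)
  have m: "mul SR6 (\<theta> x) (\<theta> y) = 3 \<longleftrightarrow> x \<notin> lin s \<and> y \<notin> lin s \<and> c x \<noteq> c y" for x y
    by (auto simp: \<theta>_def SR6_def doubleton_eq_iff)
  have "eval SR6 \<theta> s = 3"
    using s disj c by (auto simp: eval_SR6_eq_3[OF \<theta>] m) (auto simp: \<theta>_def)
  then have t3: "eval SR6 \<theta> t = 3"
    using iff[OF \<theta>] by blast
  then have t: "\<not> long t" and quad_t: "\<And>x y. (x, y) \<in> quad t \<Longrightarrow> x \<notin> lin s \<and> y \<notin> lin s \<and> c x \<noteq> c y"
    and lin_t: "\<forall>x\<in>lin t. \<theta> x = 3"
    by (auto simp: eval_SR6_eq_3[OF \<theta>] m)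
  have "lin t \<subseteq> lin s"
    using lin_t by (auto simp: \<theta>_def split: if_splits)
  moreover have "x \<in> lin t" if x: "x \<in> lin s" for x
  proof (rule ccontr)
    assume "x \<notin> lin t"
    let ?\<eta> = "\<theta>(x := 1)"
    have \<eta>: "range ?\<eta> \<subseteq> carrier SR6"
      using \<theta> by (auto simp: SR6_def)
    have "?\<eta> y = \<theta> y" if "y \<in> lin t" for y
      using \<open>x \<notin> lin t\<close> that by auto
    moreover have "?\<eta> y = \<theta> y \<and> ?\<eta> z = \<theta> z" if "(y, z) \<in> quad t" for y z
      using quad_t[OF that] x by auto
    ultimately have "eval SR6 ?\<eta> t = 3"
      using t3 unfolding eval_SR6_eq_3[OF \<theta>] eval_SR6_eq_3[OF \<eta>] by fastforce
    then have "eval SR6 ?\<eta> s = 3"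
      using iff[OF \<eta>] by simp
    then show False
      using x unfolding eval_SR6_eq_3[OF \<eta>] by auto
  qed
  ultimately have lin: "lin t = lin s"
    by blast
  define \<eta> where "\<eta> a b = (\<lambda>x. if x = a then 2 else if x = b then 4 else \<theta> x)" for a b
  have edge: "(a, b) \<in> quad s \<union> (quad s)\<inverse> \<longleftrightarrow> (a, b) \<in> quad t \<union> (quad t)\<inverse>"
    if ab: "c a" "\<not> c b" "a \<notin> lin s" "b \<notin> lin s" for a b
  proof -
    have \<eta>: "range (\<eta> a b) \<subseteq> carrier SR6"
      by (auto simp: \<eta>_def \<theta>_def SR6_def)
    have m: "mul SR6 (\<eta> a b x) (\<eta> a b y) = 3 \<longleftrightarrow> {x, y} \<noteq> {a, b}"
      if "x \<notin> lin s" "y \<notin> lin s" "c x \<noteq> c y" for x y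
      using that ab by (auto simp: \<eta>_def \<theta>_def SR6_def doubleton_eq_iff)
    have "eval SR6 (\<eta> a b) u = 3 \<longleftrightarrow> (a, b) \<notin> quad u \<union> (quad u)\<inverse>"
      if "lin u = lin s" "\<not> long u"
        and q: "\<And>x y. (x, y) \<in> quad u \<Longrightarrow> x \<notin> lin s \<and> y \<notin> lin s \<and> c x \<noteq> c y" for u
    proof -
      have "\<forall>x\<in>lin u. \<eta> a b x = 3"
        using that ab by (auto simp: \<eta>_def \<theta>_def)
      moreover have "mul SR6 (\<eta> a b x) (\<eta> a b y) = 3 \<longleftrightarrow> {x, y} \<noteq> {a, b}" if "(x, y) \<in> quad u" for x y
        using q[OF that] m by blast
      ultimately show ?thesis
        using \<open>\<not> long u\<close> by (auto simp: eval_SR6_eq_3[OF \<eta>] doubleton_eq_iff)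
    qed
    from this[OF refl s] this[OF lin t] show ?thesis
      using iff[OF \<eta>] disj c quad_t by blast
  qed
  have "(x, y) \<in> quad t \<union> (quad t)\<inverse> \<longleftrightarrow> (x, y) \<in> quad s \<union> (quad s)\<inverse>" for x y
    using edge[of x y] edge[of y x] disj c quad_t by (cases "c x"; cases "c y") blast+
  then show ?thesis
    using lin t by auto
qed

section \<open>The ai-semiring of a graph\<close>

text \<open>
  The sums of vertices and the sums of edges of a graph, with everything else collapsed to
  \<open>Inf\<close>. A product of two sums of vertices survives if it expands to edges only; the edge set
  is symmetric, and \<open>elem_mul\<close> records each edge in both directions to be commutative.
\<close>

datatype 'v elem = Inf | Lin "'v set" | Quad "('v \<times> 'v) set"

fun elem_add :: "'v elem \<Rightarrow> 'v elem \<Rightarrow> 'v elem" where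
  "elem_add (Lin X) (Lin Y) = Lin (X \<union> Y)"
| "elem_add (Quad F) (Quad G) = Quad (F \<union> G)"
| "elem_add _ _ = Inf"

fun elem_mul :: "('v \<times> 'v) set \<Rightarrow> 'v elem \<Rightarrow> 'v elem \<Rightarrow> 'v elem" where
  "elem_mul E (Lin X) (Lin Y) = (if X \<times> Y \<subseteq> E then Quad (X \<times> Y \<union> Y \<times> X) else Inf)"
| "elem_mul E _ _ = Inf"

text \<open>
  An element \<open>Lin X\<close> has nonempty \<open>X\<close>, so that any two factors of a product different from \<open>Inf\<close>
  contain adjacent vertices.
\<close>

definition graph_alg :: "'v set \<Rightarrow> ('v \<times> 'v) set \<Rightarrow> 'v elem alg" where
  "graph_alg V E = \<lparr>carrier = insert Inf (Lin ` {X. X \<noteq> {} \<and> X \<subseteq> V} \<union> Quad ` Pow E),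
     add = elem_add, mul = elem_mul E\<rparr>"

lemma finite_graph_alg: "finite V \<Longrightarrow> finite E \<Longrightarrow> finite (carrier (graph_alg V E))"
  by (simp add: graph_alg_def)

lemma graph_alg_simps [simp]:
  "add (graph_alg V E) = elem_add" "mul (graph_alg V E) = elem_mul E"
  by (simp_all add: graph_alg_def)

lemma nilpotent3_graph_alg:
  assumes E: "sym E"
  shows "nilpotent3 (graph_alg V E) Inf"
proof -
  have swap: "Y \<times> X \<subseteq> E" if "X \<times> Y \<subseteq> E" for X Y
    using that E by (auto dest: symD)
  have assoc: "elem_add (elem_add x y) z = elem_add x (elem_add y z)" for x y z :: "'a elem"
    by (cases x; cases y; cases z) auto
  have comm: "elem_add x y = elem_add y x" for x y :: "'a elem"
    by (cases x; cases y) auto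
  have mul3: "elem_mul E (elem_mul E x y) z = Inf" "elem_mul E x (elem_mul E y z) = Inf" for x y z
    by (cases x; cases y; cases z; auto)+
  have mcomm: "elem_mul E x y = elem_mul E y x" for x y
    by (cases x; cases y) (auto dest: swap)
  have distrib: "elem_mul E x (elem_add y z) = elem_add (elem_mul E x y) (elem_mul E x z)" for x y z
    by (cases x; cases y; cases z) auto
  have closed: "elem_add x y \<in> carrier (graph_alg V E)" "elem_mul E x y \<in> carrier (graph_alg V E)"
    if "x \<in> carrier (graph_alg V E)" "y \<in> carrier (graph_alg V E)" for x y
    using that swap by (auto simp: graph_alg_def split: if_splits)
  have "elem_add x x = x" "elem_add x Inf = Inf" for x :: "'a elem"
    by (cases x; simp)+
  then show ?thesis
    using closed
    by unfold_locales
      (auto simp: graph_alg_def assoc mul3 distrib mcomm[of "elem_add _ _"] mcomm comm)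
qed

text \<open>
  The hypothesis \<open>bip\<close> makes all subgraphs on at most \<open>k\<close> vertices bipartite. The graph of a term in
  at most \<open>k\<close> variables whose value is not \<open>Inf\<close> maps into such a subgraph, by a choice of vertices
  from the values of the variables, and inherits its 2-colouring. Since \<open>s\<close> and \<open>t\<close> play symmetric
  roles, it is enough to treat the assignments under which \<open>s\<close> has a value other than \<open>Inf\<close>.
\<close>

lemma graph_alg_satisfies_small:
  fixes s t :: "'x trm" and V :: "'v set"
  assumes E: "sym E" "E \<subseteq> V \<times> V"
    and bip: "\<And>W. W \<subseteq> V \<Longrightarrow> card W \<le> k \<Longrightarrow> \<exists>c :: 'v \<Rightarrow> bool. \<forall>(x, y)\<in>E \<inter> W \<times> W. c x \<noteq> c y"
    and st: "satisfies SR6 (s, t)" and k: "card (set_trm s) \<le> k" "card (set_trm t) \<le> k"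
  shows "satisfies (graph_alg V E) (s, t)"
proof -
  let ?A = "graph_alg V E"
  interpret A: nilpotent3 ?A Inf
    by (rule nilpotent3_graph_alg[OF E(1)])
  have eq: "eval ?A \<theta> s = eval ?A \<theta> t"
    if st: "satisfies SR6 (s, t)" and k: "card (set_trm s) \<le> k" and \<theta>: "range \<theta> \<subseteq> carrier ?A"
      and fin: "eval ?A \<theta> s \<noteq> Inf" for s t :: "'x trm" and \<theta>
  proof -
    have long: "\<not> long s"
      using A.monomials_le_eval(3)[OF \<theta>] fin by blast
    show ?thesis
    proof (cases "quad s = {}")
      case True
      then show ?thesis
        using SR6_identity_linear[OF st _ long] long by (intro A.eval_eqI[OF \<theta>]) auto
    next
      case False
      have factor: "\<exists>X Y. \<theta> x = Lin X \<and> \<theta> y = Lin Y \<and> X \<times> Y \<subseteq> E \<and> (\<exists>F. eval ?A \<theta> s = Quad F)"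
        if "(x, y) \<in> quad s" for x y
        using A.monomials_le_eval(2)[OF \<theta> that] fin
        by (cases "\<theta> x"; cases "\<theta> y"; cases "eval ?A \<theta> s")
          (auto simp: A.le_def split: if_splits)
      then obtain F where F: "eval ?A \<theta> s = Quad F"
        using False by fastforce
      have lin: "\<exists>G. \<theta> x = Quad G" if "x \<in> lin s" for x
        using A.monomials_le_eval(1)[OF \<theta> that]
        by (cases "\<theta> x") (auto simp: F A.le_def)
      have disj: "x \<notin> lin s \<and> y \<notin> lin s" if "(x, y) \<in> quad s" for x y
        using factor[OF that] lin by fastforce
      \<comment> \<open>Any vertex in the value of a variable will do, and adjacent variables get adjacent vertices.\<close>
      define r where "r x = (SOME v. \<exists>X. \<theta> x = Lin X \<and> v \<in> X)" for x
      have r: "r x \<in> X" if "\<theta> x = Lin X" for x X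
      proof -
        have "\<theta> x \<in> carrier ?A"
          using \<theta> by auto
        then have "\<exists>v. v \<in> X"
          using that by (auto simp: graph_alg_def)
        then show ?thesis
          using that by (auto simp: r_def intro: someI)
      qed
      have rE: "(r x, r y) \<in> E" if "(x, y) \<in> quad s" for x y
        using factor[OF that] r by blast
      let ?W = "V \<inter> r ` set_trm s"
      have "card ?W \<le> card (r ` set_trm s)"
        by (intro card_mono finite_imageI finite_set_trm) auto
      also have "\<dots> \<le> k"
        using card_image_le[OF finite_set_trm, of r s] k by linarith
      finally obtain c :: "'v \<Rightarrow> bool" where c: "\<forall>(x, y)\<in>E \<inter> ?W \<times> ?W. c x \<noteq> c y"
        using bip[of ?W] by auto
      have "(c \<circ> r) x \<noteq> (c \<circ> r) y" if "(x, y) \<in> quad s" for x y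
        using c rE[OF that] quad_subset[of s] that E(2) by auto
      from SR6_identity_bipartite[OF st long disj this] show ?thesis
        using long by (intro A.eval_eqI[OF \<theta>]) simp_all
    qed
  qed
  have ts: "satisfies SR6 (t, s)"
    using st by (simp add: satisfies_def)
  show ?thesis
    unfolding satisfies_def
    using eq[OF st k(1)] eq[OF ts k(2)] by fastforce
qed

section \<open>Odd cycles\<close>

text \<open>
  The vertices are \<open>0, \<dots>, n\<close>, so the cycle is odd for even \<open>n\<close>.
\<close>

definition cycle :: "nat \<Rightarrow> (nat \<times> nat) set" where
  "cycle n = (let F = insert (n, 0) {(i, Suc i) | i. i < n} in F \<union> F\<inverse>)"

lemma cycle_sym: "sym (cycle n)"
  by (auto simp: cycle_def Let_def intro: symI)

lemma cycle_subset: "cycle n \<subseteq> {..n} \<times> {..n}"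
  by (auto simp: cycle_def Let_def)

text \<open>
  Colour by parity, and flip the colours above a missing vertex \<open>p\<close>. No edge that
  avoids \<open>p\<close> crosses it, except the edge between the even numbers \<open>n\<close> and \<open>0\<close>, whose ends the flip
  makes different.
\<close>

lemma cycle_proper_subset_bipartite:
  assumes n: "even n" and W: "W \<subseteq> {..n}" "card W \<le> n"
  shows "\<exists>c :: nat \<Rightarrow> bool. \<forall>(x, y)\<in>cycle n \<inter> W \<times> W. c x \<noteq> c y"
proof -
  obtain p where p: "p \<le> n" "p \<notin> W"
  proof -
    have "W \<noteq> {..n}"
      using W by auto
    then show thesis
      using W that by blast
  qed
  have "\<forall>(x, y)\<in>cycle n \<inter> W \<times> W. (even x \<longleftrightarrow> x < p) \<noteq> (even y \<longleftrightarrow> y < p)"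
  proof clarify
    fix x y assume "(x, y) \<in> cycle n" "x \<in> W" "y \<in> W" "(even x \<longleftrightarrow> x < p) = (even y \<longleftrightarrow> y < p)"
    moreover from this have "x \<noteq> p" "y \<noteq> p"
      using p by auto
    ultimately show False
      using n p(1) by (auto simp: cycle_def Let_def)
  qed
  then show ?thesis
    by (intro exI)
qed

primrec path_trm :: "nat \<Rightarrow> nat trm \<Rightarrow> nat trm" where
  "path_trm 0 t = t"
| "path_trm (Suc n) t = Add (path_trm n t) (Mul (Var n) (Var (Suc n)))"

definition cycle_trm :: "nat \<Rightarrow> nat trm" where
  "cycle_trm n = path_trm n (Mul (Var n) (Var 0))"

lemma monomials_cycle_trm:
  "quad (cycle_trm n) = insert (n, 0) {(i, Suc i) | i. i < n}"
proof -
  have "quad (path_trm m t) = quad t \<union> {(i, Suc i) | i. i < m}" for m t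
    by (induction m) (auto simp: less_Suc_eq)
  then show ?thesis
    by (simp add: cycle_trm_def)
qed

text \<open>
  A value other than \<open>1\<close> would make all the edges equal to \<open>3\<close>, and then the classes \<open>{2, 5}\<close> and
  \<open>{4, 6}\<close> alternate around an odd cycle. A product of two products is \<open>1\<close>, so squaring the term is a
  way to write this value without a constant.
\<close>

lemma SR6_odd_cycle:
  assumes n: "even n"
  shows "satisfies SR6 (cycle_trm n, Mul (cycle_trm n) (cycle_trm n))"
proof -
  have "eval SR6 \<theta> (cycle_trm n) = 1" if \<theta>: "range \<theta> \<subseteq> carrier SR6" for \<theta>
  proof (rule ccontr)
    assume "eval SR6 \<theta> (cycle_trm n) \<noteq> 1"
    then have "mul SR6 (\<theta> x) (\<theta> y) \<noteq> 1" if "(x, y) \<in> quad (cycle_trm n)" for x y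
      using SR6.monomials_le_eval(2)[OF \<theta> that] SR6.top_le[OF SR6.eval_in_carrier[OF \<theta>]] by metis
    moreover have "a \<in> {2, 5} \<longleftrightarrow> b \<notin> {2, 5}" if "mul SR6 a b \<noteq> 1" for a b
      using that by (auto simp: SR6_def doubleton_eq_iff split: if_splits)
    ultimately have col: "\<theta> x \<in> {2, 5} \<longleftrightarrow> \<theta> y \<notin> {2, 5}" if "(x, y) \<in> quad (cycle_trm n)" for x y
      using that by blast
    have "i \<le> n \<Longrightarrow> \<theta> i \<in> {2, 5} \<longleftrightarrow> (even i \<longleftrightarrow> \<theta> 0 \<in> {2, 5})" for i
    proof (induction i)
      case (Suc i)
      then show ?case
        using col[of i "Suc i"] by (auto simp: monomials_cycle_trm)
    qed simp
    from this[of n] show False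
      using n col[of n 0] by (auto simp: monomials_cycle_trm)
  qed
  moreover have "mul SR6 1 1 = 1"
    by (simp add: SR6_def)
  ultimately show ?thesis
    by (simp add: satisfies_def)
qed

lemma graph_alg_odd_cycle:
  "\<not> satisfies (graph_alg {..n} (cycle n)) (cycle_trm n, Mul (cycle_trm n) (cycle_trm n))"
proof -
  let ?A = "graph_alg {..n} (cycle n)" and ?\<theta> = "\<lambda>i. Lin {min i n}"
  \<comment> \<open>Each variable of the term denotes its own vertex; \<open>min\<close> only keeps the others inside \<open>{..n}\<close>.\<close>
  have \<theta>: "range ?\<theta> \<subseteq> carrier ?A"
    by (auto simp: graph_alg_def)
  have mem: "(i, Suc i) \<in> cycle n" if "i < n" for i
    using that by (auto simp: cycle_def Let_def)
  have n0: "(n, 0) \<in> cycle n"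
    by (simp add: cycle_def Let_def)
  have "m \<le> n \<Longrightarrow> \<exists>F. eval ?A ?\<theta> (path_trm m (Mul (Var n) (Var 0))) = Quad F" for m
  proof (induction m)
    case 0
    then show ?case using n0 by (simp add: graph_alg_def)
  next
    case (Suc m)
    then show ?case using mem[of m] by (auto simp: graph_alg_def min_def)
  qed
  then obtain F where F: "eval ?A ?\<theta> (cycle_trm n) = Quad F"
    by (auto simp: cycle_trm_def)
  then have "eval ?A ?\<theta> (cycle_trm n) \<noteq> eval ?A ?\<theta> (Mul (cycle_trm n) (cycle_trm n))"
    by simp
  then show ?thesis
    using \<theta> unfolding satisfies_def fst_conv snd_conv by blast
qed

theorem corollary4p7: "nonfinitely_based SR6"
proof
  assume fb: "finitely_based SR6"
  show False
  proof (rule finitely_based_bounded_variables[OF ai_semiring_SR6 fb, where 'a = "nat elem"])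
    fix k
    assume k: "\<And>(A :: nat elem alg) e. \<lbrakk>ai_semiring A; finite (carrier A);
        \<And>s t :: nat trm. \<lbrakk>satisfies SR6 (s, t); card (set_trm s) \<le> k; card (set_trm t) \<le> k\<rbrakk>
          \<Longrightarrow> satisfies A (s, t);
        satisfies SR6 (e :: nat identity)\<rbrakk> \<Longrightarrow> satisfies A e"
    \<comment> \<open>An even number that is at least \<open>k\<close>: the cycle has \<open>2 * k + 1\<close> vertices.\<close>
    let ?n = "2 * k"
    let ?A = "graph_alg {..?n} (cycle ?n)"
    interpret A: nilpotent3 ?A Inf
      by (rule nilpotent3_graph_alg[OF cycle_sym])
    have "finite (carrier ?A)"
      by (intro finite_graph_alg finite_subset[OF cycle_subset]) auto
    moreover have "satisfies ?A (s, t)"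
      if "satisfies SR6 (s, t)" "card (set_trm s) \<le> k" "card (set_trm t) \<le> k" for s t :: "nat trm"
      using that cycle_proper_subset_bipartite[of ?n]
      by (intro graph_alg_satisfies_small[OF cycle_sym cycle_subset, where k = k]) auto
    moreover have "satisfies SR6 (cycle_trm ?n, Mul (cycle_trm ?n) (cycle_trm ?n))"
      by (rule SR6_odd_cycle) simp
    ultimately show False
      using k[OF A.ai_semiring_axioms] graph_alg_odd_cycle by blast
  qed
qed

end
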